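(* Let $W$ be an $n\times n$ Type 2 matrix power function with unitary $U(x)$ and associated eigenvalues $\alpha_i|x|^{\gamma_i}$, $1\le i\le n$. Then $W(x)$ is positive definite for a.e. $x\in\mathbb{R}$ and has locally integrable entries if and only if $\gamma_i>-1$ and $\alpha_i>0$ for $1\le i\le n$.
   Context: An $n\times n$ Type 2 matrix power function is a matrix-valued function of the real variable $x$ of the form $$W(x)=U(x)\,\mathrm{diag}\left(\alpha_1|x|^{\gamma_1},\dots,\alpha_n|x|^{\gamma_n}\right)U^*(x),$$ where each $\alpha_i\in\mathbb{C}$, each $\gamma_i\in\mathbb{R}$, the interior matrix is diagonal, and $U(x)$ is an $n\times n$ unitary matrix for a.e. $x\in\mathbb{R}$; here $U^*(x)$ is the conjugate transpose of $U(x)$. The condition $\alpha_i>0$ means that $\alpha_i$ is real and strictly positive. A complex square matrix is positive definite if it is self-adjoint with positive eigenvalues. Locally integrable means integrable over every finite interval of $\mathbb{R}$.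
   Formalization: The entries of W are additionally assumed Lebesgue measurable; without this a non-measurable unitary U(x) can make W's entries non-measurable, hence not locally integrable, although all γ_i>-1 and α_i>0. *)

theory Defs
  imports "HOL-Analysis.Analysis" "Jordan_Normal_Form.Schur_Decomposition"
begin

definition unitary_matrix :: "nat \<Rightarrow> complex mat \<Rightarrow> bool" where
  "unitary_matrix n U \<longleftrightarrow>
     U \<in> carrier_mat n n \<and>
     U * mat_adjoint U = 1\<^sub>m n \<and> mat_adjoint U * U = 1\<^sub>m n"

definition pos_complex :: "complex \<Rightarrow> bool" where
  "pos_complex z \<longleftrightarrow> z \<in> \<real> \<and> 0 < Re z"

definition positive_definite :: "complex mat \<Rightarrow> bool" where
  "positive_definite A \<longleftrightarrow>
     square_mat A \<and> mat_adjoint A = A \<and> (\<forall>k. eigenvalue A k \<longrightarrow> pos_complex k)"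

text \<open>
  A matrix-valued function is understood to be Lebesgue measurable (entrywise). This is required
  of W only; it holds in particular whenever the entries of U are measurable.
  The factorization is required almost everywhere: the powers of the absolute value of x are
  undefined at x = 0 for negative exponents (where powr returns 0), and U is only
  controlled almost everywhere. Rows and columns are indexed by 0, ..., n - 1.
\<close>

definition type2_matrix_power_function ::
  "nat \<Rightarrow> (real \<Rightarrow> complex mat) \<Rightarrow> (real \<Rightarrow> complex mat) \<Rightarrow>
   (nat \<Rightarrow> complex) \<Rightarrow> (nat \<Rightarrow> real) \<Rightarrow> bool" where
  "type2_matrix_power_function n W U \<alpha> \<gamma> \<longleftrightarrow>
     (\<forall>x. W x \<in> carrier_mat n n) \<and>
     (\<forall>i<n. \<forall>j<n. (\<lambda>x. W x $$ (i, j)) \<in> borel_measurable lebesgue) \<and>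
     (AE x in lebesgue. unitary_matrix n (U x)) \<and>
     (AE x in lebesgue.
        W x = U x * mat_diag n (\<lambda>i. \<alpha> i * complex_of_real (\<bar>x\<bar> powr \<gamma> i)) * mat_adjoint (U x))"

definition locally_integrable :: "(real \<Rightarrow> complex) \<Rightarrow> bool" where
  "locally_integrable f \<longleftrightarrow> (\<forall>a b. f absolutely_integrable_on {a..b})"

end

theory Submission
  imports Defs
begin

text \<open>
  The argument separates the two properties. Almost everywhere \<open>W x\<close> is unitarily similar to a
  diagonal matrix with entries \<open>d\<^sub>i(x) = \<alpha>\<^sub>i |x|\<^sup>\<gamma>\<^sub>i\<close> and \<open>x \<noteq> 0\<close>, so its eigenvalues are exactly the
  \<open>d\<^sub>i(x)\<close>, and these are positive precisely when the \<open>\<alpha>\<^sub>i\<close> are. Hence positive definiteness almost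
  everywhere is equivalent to positivity of all \<open>\<alpha>\<^sub>i\<close>, whatever the exponents
  (\<open>positive_definite_unitary_diag_iff\<close>).

  For integrability, the entries of a unitary matrix have modulus at most 1. Conjugation by a
  unitary matrix therefore produces a matrix whose entries are bounded by the sum of the moduli of
  the entries of the original one (\<open>unitary_conjugation_entry_le\<close>). Since the diagonal matrix is
  obtained from \<open>W x\<close> by conjugation with the adjoint of \<open>U x\<close>, which is again unitary, the
  bound applies both ways: the entries of \<open>W\<close> are dominated by the sum of the \<open>|d\<^sub>i|\<close>, and each
  \<open>|d\<^sub>i|\<close> is dominated by the sum of the moduli of the entries of \<open>W\<close>. As \<open>\<alpha>\<^sub>i \<noteq> 0\<close>, local
  integrability of \<open>W\<close> amounts to that of every \<open>|x|\<^sup>\<gamma>\<^sub>i\<close>, which holds exactly for \<open>\<gamma>\<^sub>i > -1\<close>.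
\<close>

section \<open>Adjoints and unitary matrices\<close>

lemma dim_mat_adjoint [simp]:
  "dim_row (mat_adjoint A) = dim_col A" "dim_col (mat_adjoint A) = dim_row A"
  by (auto simp: mat_adjoint_def)

lemma mat_adjoint_carrier [simp]:
  "A \<in> carrier_mat n m \<Longrightarrow> mat_adjoint A \<in> carrier_mat m n"
  by auto

lemma mat_adjoint_entry:
  fixes A :: "complex mat"
  assumes "A \<in> carrier_mat n m" "i < m" "j < n"
  shows "mat_adjoint A $$ (i, j) = cnj (A $$ (j, i))"
  using assms by (auto simp: mat_adjoint_def mat_of_rows_index conjugate_complex_def)

lemma mat_adjoint_adjoint:
  fixes A :: "complex mat"
  assumes "A \<in> carrier_mat n m"
  shows "mat_adjoint (mat_adjoint A) = A"
proof (rule eq_matI)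
  have A': "mat_adjoint A \<in> carrier_mat m n" using assms by simp
  show "dim_row (mat_adjoint (mat_adjoint A)) = dim_row A"
    "dim_col (mat_adjoint (mat_adjoint A)) = dim_col A"
    by simp_all
  fix i j assume "i < dim_row A" "j < dim_col A"
  then show "mat_adjoint (mat_adjoint A) $$ (i, j) = A $$ (i, j)"
    using mat_adjoint_entry[OF A', of i j] mat_adjoint_entry[OF assms, of j i] assms by auto
qed

lemma mat_mult_entry:
  assumes "A \<in> carrier_mat n m" "B \<in> carrier_mat m p" "i < n" "j < p"
  shows "(A * B) $$ (i, j) = (\<Sum>k<m. A $$ (i, k) * B $$ (k, j))"
  using assms by (auto simp: scalar_prod_def atLeast0LessThan)

lemma mat_adjoint_mult:
  fixes A B :: "complex mat"
  assumes A: "A \<in> carrier_mat n m" and B: "B \<in> carrier_mat m p"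
  shows "mat_adjoint (A * B) = mat_adjoint B * mat_adjoint A"
proof (rule eq_matI)
  have AB: "A * B \<in> carrier_mat n p" using assms by simp
  have A': "mat_adjoint A \<in> carrier_mat m n" and B': "mat_adjoint B \<in> carrier_mat p m"
    and AB': "mat_adjoint (A * B) \<in> carrier_mat p n"
    using A B AB by (blast intro: mat_adjoint_carrier)+
  show "dim_row (mat_adjoint (A * B)) = dim_row (mat_adjoint B * mat_adjoint A)"
    "dim_col (mat_adjoint (A * B)) = dim_col (mat_adjoint B * mat_adjoint A)"
    using A' B' AB' by auto
  fix i j assume "i < dim_row (mat_adjoint B * mat_adjoint A)" "j < dim_col (mat_adjoint B * mat_adjoint A)"
  then have i: "i < p" and j: "j < n" using A' B' by auto
  show "mat_adjoint (A * B) $$ (i, j) = (mat_adjoint B * mat_adjoint A) $$ (i, j)"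
    unfolding mat_adjoint_entry[OF AB i j] mat_mult_entry[OF A B j i] mat_mult_entry[OF B' A' i j]
    by (auto simp: mat_adjoint_entry[OF A _ j] mat_adjoint_entry[OF B i] mult.commute intro!: sum.cong)
qed

lemma mat_adjoint_diag:
  "mat_adjoint (mat_diag n d) = mat_diag n (\<lambda>i. cnj (d i))"
proof (rule eq_matI)
  have D: "mat_diag n d \<in> carrier_mat n n" by simp
  show "dim_row (mat_adjoint (mat_diag n d)) = dim_row (mat_diag n (\<lambda>i. cnj (d i)))"
    "dim_col (mat_adjoint (mat_diag n d)) = dim_col (mat_diag n (\<lambda>i. cnj (d i)))"
    by (simp_all add: mat_diag_def)
  fix i j assume "i < dim_row (mat_diag n (\<lambda>i. cnj (d i)))" "j < dim_col (mat_diag n (\<lambda>i. cnj (d i)))"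
  then show "mat_adjoint (mat_diag n d) $$ (i, j) = mat_diag n (\<lambda>i. cnj (d i)) $$ (i, j)"
    using mat_adjoint_entry[OF D, of i j] by (auto simp: mat_diag_def)
qed

lemma unitary_matrix_adjoint:
  assumes "unitary_matrix n U" shows "unitary_matrix n (mat_adjoint U)"
  using assms mat_adjoint_adjoint[of U n n] by (auto simp: unitary_matrix_def)

text \<open>
  The diagonal entries of \<open>U * mat_adjoint U = 1\<close> say that every row of \<open>U\<close> is a unit vector.
\<close>
lemma unitary_entry_norm_le_1:
  assumes U: "unitary_matrix n U" and i: "i < n" and j: "j < n"
  shows "norm (U $$ (i, j)) \<le> 1"
proof -
  have C: "U \<in> carrier_mat n n" and C': "mat_adjoint U \<in> carrier_mat n n"
    using U by (auto simp: unitary_matrix_def)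
  have "1 = (U * mat_adjoint U) $$ (i, i)" using U i by (simp add: unitary_matrix_def)
  also have "\<dots> = (\<Sum>k<n. U $$ (i, k) * cnj (U $$ (i, k)))"
    unfolding mat_mult_entry[OF C C' i i] by (auto simp: mat_adjoint_entry[OF C _ i])
  also have "\<dots> = complex_of_real (\<Sum>k<n. (norm (U $$ (i, k)))\<^sup>2)"
    by (simp only: of_real_sum complex_norm_square)
  finally have "(\<Sum>k<n. (norm (U $$ (i, k)))\<^sup>2) = 1"
    by (metis of_real_eq_1_iff)
  moreover have "(norm (U $$ (i, j)))\<^sup>2 \<le> (\<Sum>k<n. (norm (U $$ (i, k)))\<^sup>2)"
    using j by (intro member_le_sum) auto
  ultimately show ?thesis by (simp add: power_le_one_iff)
qed

text \<open>
  An entry of the product is a combination of the entries of \<open>A\<close> whose coefficients are products of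
  two entries of unitary matrices, hence of modulus at most 1. The bound is uniform in
  \<open>U\<close>; it will be used both with the diagonal matrix and with \<open>W x\<close> as \<open>A\<close>.
\<close>
lemma unitary_conjugation_entry_le:
  assumes U: "unitary_matrix n U" and A: "A \<in> carrier_mat n n" and i: "i < n" and j: "j < n"
  shows "norm ((U * A * mat_adjoint U) $$ (i, j)) \<le> (\<Sum>k<n. \<Sum>l<n. norm (A $$ (l, k)))"
proof -
  have C: "U \<in> carrier_mat n n" and C': "mat_adjoint U \<in> carrier_mat n n"
    and UA: "U * A \<in> carrier_mat n n"
    using U A by (auto simp: unitary_matrix_def)
  have le: "norm (U $$ (i, l) * A $$ (l, k) * mat_adjoint U $$ (k, j)) \<le> norm (A $$ (l, k))"
    if "k < n" "l < n" for k l
  proof -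
    have "norm (U $$ (i, l)) * norm (A $$ (l, k)) \<le> norm (A $$ (l, k))"
      using unitary_entry_norm_le_1[OF U i that(2)] by (simp add: mult_left_le_one_le)
    then have "norm (U $$ (i, l)) * norm (A $$ (l, k)) * norm (mat_adjoint U $$ (k, j))
        \<le> norm (A $$ (l, k)) * 1"
      using unitary_entry_norm_le_1[OF unitary_matrix_adjoint[OF U] that(1) j]
      by (intro mult_mono) auto
    then show ?thesis by (simp add: norm_mult)
  qed
  have "(U * A * mat_adjoint U) $$ (i, j)
      = (\<Sum>k<n. \<Sum>l<n. U $$ (i, l) * A $$ (l, k) * mat_adjoint U $$ (k, j))"
    unfolding mat_mult_entry[OF UA C' i j]
    by (auto simp: mat_mult_entry[OF C A i] sum_distrib_right intro!: sum.cong)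
  also have "norm \<dots> \<le> (\<Sum>k<n. \<Sum>l<n. norm (A $$ (l, k)))"
    by (intro sum_norm_le) (use le in auto)
  finally show ?thesis .
qed

lemma unitary_conjugation_inverse:
  assumes U: "unitary_matrix n U" and A: "A \<in> carrier_mat n n"
  shows "mat_adjoint U * (U * A * mat_adjoint U) * mat_adjoint (mat_adjoint U) = A"
proof -
  have C: "U \<in> carrier_mat n n" and C': "mat_adjoint U \<in> carrier_mat n n"
    and inv: "mat_adjoint U * U = 1\<^sub>m n"
    using U by (auto simp: unitary_matrix_def)
  have "mat_adjoint U * (U * A * mat_adjoint U) * U
      = (mat_adjoint U * U) * A * (mat_adjoint U * U)"
    using A C C' by (smt (verit, best) assoc_mult_mat mult_carrier_mat)
  then show ?thesis using A by (simp add: inv mat_adjoint_adjoint[OF C])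
qed

section \<open>Positive definiteness of a unitarily diagonalised matrix\<close>

text \<open>
  Similar matrices have the same characteristic polynomial, and that of a diagonal matrix is the
  product of the linear factors \<open>X - d i\<close>.
\<close>
lemma eigenvalue_unitary_diag_iff:
  assumes U: "unitary_matrix n U"
  shows "eigenvalue (U * mat_diag n d * mat_adjoint U) k \<longleftrightarrow> (\<exists>i<n. k = d i)"
proof -
  let ?W = "U * mat_diag n d * mat_adjoint U" and ?D = "mat_diag n d"
  have C: "U \<in> carrier_mat n n" and C': "mat_adjoint U \<in> carrier_mat n n"
    using U by (auto simp: unitary_matrix_def)
  have D: "?D \<in> carrier_mat n n" by simp
  have W: "?W \<in> carrier_mat n n" using mult_carrier_mat[OF mult_carrier_mat[OF C D] C'] .
  have sim: "similar_mat ?W ?D"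
    by (rule similar_matI[of _ _ U "mat_adjoint U" n])
      (use U W C C' D in \<open>auto simp: unitary_matrix_def\<close>)
  have "upper_triangular ?D"
    by (auto simp: mat_diag_def)
  then have "char_poly ?W = (\<Prod>a\<leftarrow>diag_mat ?D. [:- a, 1:])"
    using char_poly_similar[OF sim] char_poly_upper_triangular[OF D] by simp
  then have "eigenvalue ?W k \<longleftrightarrow> (\<Prod>a\<leftarrow>diag_mat ?D. k - a) = 0"
    unfolding eigenvalue_root_char_poly[OF W] by (simp add: poly_prod_list o_def)
  also have "\<dots> \<longleftrightarrow> (\<exists>i<n. k = d i)"
    by (auto simp: prod_list_zero_iff diag_mat_def mat_diag_def)
  finally show ?thesis .
qed

text \<open>
  Positive eigenvalues are in particular real, so the diagonal factor is its own adjoint; this gives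
  the self-adjointness of the product.
\<close>
lemma positive_definite_unitary_diag_iff:
  assumes U: "unitary_matrix n U"
  shows "positive_definite (U * mat_diag n d * mat_adjoint U) \<longleftrightarrow> (\<forall>i<n. pos_complex (d i))"
    (is "positive_definite ?W \<longleftrightarrow> _")
proof
  assume "positive_definite ?W"
  then show "\<forall>i<n. pos_complex (d i)"
    by (auto simp: positive_definite_def eigenvalue_unitary_diag_iff[OF U])
next
  assume pos: "\<forall>i<n. pos_complex (d i)"
  have C: "U \<in> carrier_mat n n" and C': "mat_adjoint U \<in> carrier_mat n n"
    and D: "mat_diag n d \<in> carrier_mat n n"
    using U by (auto simp: unitary_matrix_def)
  have UD: "U * mat_diag n d \<in> carrier_mat n n" using C D by simp
  have W: "?W \<in> carrier_mat n n" using UD C' by simp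
  have "mat_adjoint (mat_diag n d) = mat_diag n d"
    unfolding mat_adjoint_diag using pos
    by (intro eq_matI) (auto simp: mat_diag_def pos_complex_def Reals_cnj_iff)
  then have "mat_adjoint ?W = U * (mat_diag n d * mat_adjoint U)"
    using mat_adjoint_mult[OF UD C'] mat_adjoint_mult[OF C D] mat_adjoint_adjoint[OF C] by simp
  also have "\<dots> = ?W" using C C' D by (simp add: assoc_mult_mat[of _ n n _ n _ n])
  finally show "positive_definite ?W"
    using pos W by (auto simp: positive_definite_def eigenvalue_unitary_diag_iff[OF U])
qed

lemma pos_complex_scale:
  assumes "0 < r"
  shows "pos_complex (z * complex_of_real r) \<longleftrightarrow> pos_complex z"
  using assms by (auto simp: pos_complex_def complex_is_Real_iff zero_less_mult_iff)

section \<open>Local integrability of power functions\<close>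

text \<open>
  For \<open>c \<le> -1\<close> the power dominates \<open>1 / x\<close> on the unit interval, whose integral over
  \<open>{\<epsilon>..1}\<close> is \<open>- ln \<epsilon>\<close> and exceeds any prescribed number.
\<close>
lemma powr_not_integrable_near_0:
  assumes f: "(\<lambda>x::real. \<bar>x\<bar> powr c) integrable_on {0..1}"
  shows "-1 < c"
proof (rule ccontr)
  assume c: "\<not> -1 < c"
  let ?f = "\<lambda>x::real. \<bar>x\<bar> powr c"
  define I where "I = integral {0..1} ?f"
  \<comment> \<open>Chosen so that the integral of \<open>1 / x\<close> over \<open>{\<epsilon>..1}\<close> is \<open>\<bar>I\<bar> + 1\<close>.\<close>
  define \<epsilon> where "\<epsilon> = exp (- \<bar>I\<bar> - 1)"
  have e: "0 < \<epsilon>" "\<epsilon> \<le> 1" "ln \<epsilon> = - \<bar>I\<bar> - 1" by (auto simp: \<epsilon>_def)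
  have inv: "((\<lambda>x. 1 / x) has_integral (ln 1 - ln \<epsilon>)) {\<epsilon>..1}"
    using e by (intro fundamental_theorem_of_calculus)
      (auto intro!: derivative_eq_intros simp: has_real_derivative_iff_has_vector_derivative[symmetric])
  have f\<epsilon>: "?f integrable_on {\<epsilon>..1}"
    by (rule integrable_on_subinterval[OF f]) (use e in auto)
  have "- ln \<epsilon> = integral {\<epsilon>..1} (\<lambda>x. 1 / x)"
    using inv by (simp add: integral_unique)
  also have "\<dots> \<le> integral {\<epsilon>..1} ?f"
  proof (rule integral_le[OF _ f\<epsilon>])
    show "(\<lambda>x. 1 / x) integrable_on {\<epsilon>..1}" using inv by blast
    fix x assume x: "x \<in> {\<epsilon>..1}"
    then have "x powr (-1) \<le> x powr c" using e c by (intro powr_mono') auto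
    then show "1 / x \<le> \<bar>x\<bar> powr c"
      using x e by (simp add: powr_minus_divide)
  qed
  also have "\<dots> \<le> I"
    unfolding I_def by (rule integral_subset_le[OF _ f\<epsilon> f]) (use e in auto)
  finally show False using e by linarith
qed

lemma abs_powr_absolutely_integrable:
  assumes c: "-1 < c"
  shows "(\<lambda>x::real. \<bar>x\<bar> powr c) absolutely_integrable_on {a..b}"
proof -
  let ?f = "\<lambda>x::real. \<bar>x\<bar> powr c"
  \<comment> \<open>The symmetric interval \<open>{- m..m}\<close> contains \<open>{a..b}\<close>; its negative half is the
      reflection of its positive half.\<close>
  define m where "m = \<bar>a\<bar> + \<bar>b\<bar>"
  have "(\<lambda>x. x powr c) integrable_on {0..m}"
    using c by (intro integrable_on_powr_from_0) (auto simp: m_def)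
  then have "?f integrable_on {0..m}"
    by (rule integrable_eq) auto
  then have pos: "?f absolutely_integrable_on {0..m}"
    by (intro nonnegative_absolutely_integrable_1) auto
  then have "(\<lambda>x. ?f (- x)) absolutely_integrable_on {- m..- 0}"
    by (subst absolutely_integrable_reflect_real)
  then have "?f absolutely_integrable_on {- m..0} \<union> {0..m}"
    using pos by (intro absolutely_integrable_Un) simp_all
  then show ?thesis
    by (rule set_integrable_subset) (auto simp: m_def)
qed

lemma set_borel_measurable_interval:
  fixes f :: "real \<Rightarrow> 'a::euclidean_space"
  assumes "f \<in> borel_measurable lebesgue"
  shows "set_borel_measurable lebesgue {a..b} f"
  unfolding set_borel_measurable_def using assms by (intro borel_measurable_scaleR borel_measurable_indicator) auto

section \<open>The characterisation\<close>

theorem theorem4p1: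
  fixes n :: nat
    and W U :: "real \<Rightarrow> complex mat"
    and \<alpha> :: "nat \<Rightarrow> complex"
    and \<gamma> :: "nat \<Rightarrow> real"
  assumes "type2_matrix_power_function n W U \<alpha> \<gamma>"
  shows "((AE x in lebesgue. positive_definite (W x)) \<and>
          (\<forall>i<n. \<forall>j<n. locally_integrable (\<lambda>x. W x $$ (i, j))))
         \<longleftrightarrow> (\<forall>i<n. \<gamma> i > -1 \<and> pos_complex (\<alpha> i))"
proof -
  define d where "d x i = \<alpha> i * complex_of_real (\<bar>x\<bar> powr \<gamma> i)" for x i
  have meas: "(\<lambda>x. W x $$ (i, j)) \<in> borel_measurable lebesgue" if "i < n" "j < n" for i j
    using assms that by (simp add: type2_matrix_power_function_def)
  have WC: "W x \<in> carrier_mat n n" for x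
    using assms by (simp add: type2_matrix_power_function_def)
  have nz: "AE x in lebesgue. x \<noteq> (0::real)"
    by (rule AE_completion[OF AE_lborel_singleton])
  have fact: "AE x in lebesgue. x \<noteq> 0 \<and> unitary_matrix n (U x)
      \<and> W x = U x * mat_diag n (d x) * mat_adjoint (U x)"
    using assms nz unfolding type2_matrix_power_function_def d_def
    by (auto elim!: AE_mp)
  have "AE x in lebesgue. positive_definite (W x) \<longleftrightarrow> (\<forall>i<n. pos_complex (\<alpha> i))"
    using fact by eventually_elim (simp add: positive_definite_unitary_diag_iff d_def pos_complex_scale)
  \<comment> \<open>The condition on \<open>\<alpha>\<close> is independent of \<open>x\<close>, and the real line is not a null set.\<close>
  then have "(AE x in lebesgue. positive_definite (W x)) \<longleftrightarrow> (AE x::real in lebesgue. \<forall>i<n. pos_complex (\<alpha> i))"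
    by (rule eventually_subst)
  also have "\<dots> \<longleftrightarrow> (\<forall>i<n. pos_complex (\<alpha> i))"
    by (simp add: eventually_const_iff ae_filter_eq_bot_iff)
  finally have pd: "(AE x in lebesgue. positive_definite (W x)) \<longleftrightarrow> (\<forall>i<n. pos_complex (\<alpha> i))" .
  have int: "(\<forall>i<n. \<forall>j<n. locally_integrable (\<lambda>x. W x $$ (i, j))) \<longleftrightarrow> (\<forall>i<n. \<gamma> i > -1)"
    if pos: "\<forall>i<n. pos_complex (\<alpha> i)"
  proof (intro iffI allI impI)
    fix i assume loc: "\<forall>i<n. \<forall>j<n. locally_integrable (\<lambda>x. W x $$ (i, j))" and i: "i < n"
    have nonzero: "\<alpha> i \<noteq> 0" using pos i by (auto simp: pos_complex_def)
    \<comment> \<open>Recover \<open>|x|\<^sup>\<gamma>\<^sub>i\<close> from \<open>W x\<close> by conjugating back with the adjoint of \<open>U x\<close>.\<close>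
    let ?g = "\<lambda>x. (\<Sum>k<n. \<Sum>l<n. norm (W x $$ (l, k))) / norm (\<alpha> i)"
    have "?g absolutely_integrable_on {0..1}"
      using loc by (intro set_integrable_divide absolutely_integrable_sum set_integrable_norm)
        (auto simp: locally_integrable_def)
    moreover have "AE x in lebesgue. x \<in> {0..1} \<longrightarrow> norm (\<bar>x\<bar> powr \<gamma> i) \<le> norm (?g x)"
      using fact
    proof eventually_elim
      case (elim x)
      then have "norm (mat_diag n (d x) $$ (i, i)) \<le> (\<Sum>k<n. \<Sum>l<n. norm (W x $$ (l, k)))"
        using unitary_conjugation_entry_le[OF unitary_matrix_adjoint WC i i, of "U x" x]
          unitary_conjugation_inverse[of n "U x" "mat_diag n (d x)"] by simp
      then have "\<bar>x\<bar> powr \<gamma> i \<le> ?g x"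
        using i nonzero by (simp add: mat_diag_def d_def norm_mult field_simps)
      then show ?case
        using powr_ge_zero[of "\<bar>x\<bar>" "\<gamma> i"] unfolding real_norm_def by linarith
    qed
    moreover have "set_borel_measurable lebesgue {0..1} (\<lambda>x. \<bar>x\<bar> powr \<gamma> i)"
      by (intro set_borel_measurable_interval measurable_completion) measurable
    ultimately have "(\<lambda>x. \<bar>x\<bar> powr \<gamma> i) absolutely_integrable_on {0..1}"
      by (blast intro: set_integrable_bound)
    then show "-1 < \<gamma> i"
      by (intro powr_not_integrable_near_0 set_lebesgue_integral_eq_integral(1))
  next
    fix i j assume \<gamma>: "\<forall>i<n. -1 < \<gamma> i" and i: "i < n" and j: "j < n"
    let ?g = "\<lambda>x. \<Sum>k<n. norm (\<alpha> k) * \<bar>x\<bar> powr \<gamma> k"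
    have bound: "AE x in lebesgue. norm (W x $$ (i, j)) \<le> norm (?g x)"
      using fact
    proof eventually_elim
      case (elim x)
      then have "norm (W x $$ (i, j)) \<le> (\<Sum>k<n. \<Sum>l<n. norm (mat_diag n (d x) $$ (l, k)))"
        using unitary_conjugation_entry_le[OF _ mat_diag_dim i j] by auto
      also have "\<dots> = (\<Sum>k<n. \<Sum>l<n. if l = k then norm (d x k) else 0)"
        by (intro sum.cong refl) (auto simp: mat_diag_def)
      also have "\<dots> = ?g x"
        by (auto simp: d_def norm_mult intro!: sum.cong)
      finally show ?case by simp
    qed
    have "(\<lambda>x. W x $$ (i, j)) absolutely_integrable_on {a..b}" for a b
    proof (rule set_integrable_bound)
      show "?g absolutely_integrable_on {a..b}"
        using \<gamma> by (intro absolutely_integrable_sum set_integrable_mult_right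
            abs_powr_absolutely_integrable) auto
      show "set_borel_measurable lebesgue {a..b} (\<lambda>x. W x $$ (i, j))"
        by (intro set_borel_measurable_interval meas i j)
      show "AE x in lebesgue. x \<in> {a..b} \<longrightarrow> norm (W x $$ (i, j)) \<le> norm (?g x)"
        using bound by eventually_elim simp
    qed
    then show "locally_integrable (\<lambda>x. W x $$ (i, j))"
      by (simp add: locally_integrable_def)
  qed
  show ?thesis using pd int by blast
qed

end
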